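(* Let $T$ be any tree with $k$ interior vertices and diameter at least $3$. Then the second Neumann eigenvalue $\lambda_2(T)$ and the largest Neumann eigenvalue $\lambda_k(T)$ satisfy $$\lambda_2(T)\ \le\ 2\ \le\ \lambda_k(T).$$
   Context: All trees are finite (connected, acyclic, simple, undirected) with at least $3$ vertices. For a tree $G=(V,E)$ the boundary $\delta\Omega_G$ is the set of all vertices of degree one, and the interior is $\Omega_G=V\setminus\delta\Omega_G$; $k=|\Omega_G|$ is the number of interior vertices. Write $x\sim y$ for adjacency. The diameter is the maximum graph distance between two vertices of $G$. For $f\in\mathbb{R}^V$ put $(\Delta f)(x)=\sum_{y\sim x}(f(x)-f(y))$ for $x\in V$, and $\frac{\partial f}{\partial\nu}(x)=\sum_{y\in\Omega_G,\,y\sim x}(f(x)-f(y))$ for $x\in\delta\Omega_G$. The Neumann eigenvalue problem asks for nonzero $f\in\mathbb{R}^V$ and $\lambda\in\mathbb{R}$ with $\Delta f=\lambda f$ on $\Omega_G$ and $\frac{\partial f}{\partial \nu}=0$ on $\delta\Omega_G$. Equivalently, the Neumann eigenvalues are the eigenvalues of $\Delta^N:\mathbb{R}^{\Omega_G}\to\mathbb{R}^{\Omega_G}$, $\Delta^N f=\Delta(\Lambda f)|_{\Omega_G}$, where $\Lambda f=f$ on $\Omega_G$ and $(\Lambda f)(x)=\frac{1}{\deg(x)}\sum_{y\sim x}f(y)$ for $x\in\delta\Omega_G$. The operator $\Delta^N$ is self-adjoint and non-negative, and its eigenvalues, counted with multiplicity, are listed as $0=\lambda_1(G)<\lambda_2(G)\le\cdots\le\lambda_k(G)$.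 *)

theory Defs
  imports
    "HOL-Analysis.Analysis"
    "HOL-Library.Multiset"
    "Graph_Theory.Digraph_Component"
    "Graph_Theory.Shortest_Path"
begin

text \<open>
  A finite simple undirected graph is a finite, loop-free, symmetric pair digraph (locale
  \<^locale>\<open>pair_graph\<close>): every undirected edge is present in both orientations. Consequently the walk
  \<open>a, b, a\<close> along a single edge is a \<^const>\<open>pre_digraph.cycle\<close>, so that \<^const>\<open>tree\<close> fails for
  every symmetric digraph with an edge. The cycles of the undirected graph are the ones with at
  least three arcs.
\<close>

definition undirected_tree :: "'a pair_pre_digraph \<Rightarrow> bool" where
  "undirected_tree G \<longleftrightarrow>
     pair_graph G \<and> Digraph_Component.connected (with_proj G) \<and>
     \<not> (\<exists>p. pre_digraph.cycle (with_proj G) p \<and> 3 \<le> length p)"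

definition graph_distance :: "'a pair_pre_digraph \<Rightarrow> 'a \<Rightarrow> 'a \<Rightarrow> ereal" where
  "graph_distance G u v = wf_digraph.\<mu> (with_proj G) (\<lambda>_. 1) u v"

definition graph_diameter :: "'a pair_pre_digraph \<Rightarrow> ereal" where
  "graph_diameter G = (SUP u\<in>pverts G. SUP v\<in>pverts G. graph_distance G u v)"

definition neighbours :: "'a pair_pre_digraph \<Rightarrow> 'a \<Rightarrow> 'a set" where
  "neighbours G x = {y. (x, y) \<in> parcs G}"

definition degree :: "'a pair_pre_digraph \<Rightarrow> 'a \<Rightarrow> nat" where
  "degree G x = out_degree (with_proj G) x"

definition boundary_vertices :: "'a pair_pre_digraph \<Rightarrow> 'a set" where
  "boundary_vertices G = {x \<in> pverts G. degree G x = 1}"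

definition interior_vertices :: "'a pair_pre_digraph \<Rightarrow> 'a set" where
  "interior_vertices G = pverts G - boundary_vertices G"

text \<open>
  For a set \<open>S\<close> of vertices, \<open>\<real>\<^sup>S\<close> is the subspace of \<^typ>\<open>real ^ 'v\<close> of the vectors whose
  coordinates outside \<open>S\<close> vanish. The vertex set is an arbitrary subset of the finite type \<open>'v\<close>.
\<close>

definition functions_on :: "'v set \<Rightarrow> (real ^ 'v::finite) set" where
  "functions_on S = {f. \<forall>x. x \<notin> S \<longrightarrow> f $ x = 0}"

definition laplacian :: "'v::finite pair_pre_digraph \<Rightarrow> real ^ 'v \<Rightarrow> real ^ 'v" where
  "laplacian G f = (\<chi> x. \<Sum>y\<in>neighbours G x. f $ x - f $ y)"

definition neumann_extension :: "'v::finite pair_pre_digraph \<Rightarrow> real ^ 'v \<Rightarrow> real ^ 'v" where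
  "neumann_extension G f =
     (\<chi> x. if x \<in> interior_vertices G then f $ x
           else if x \<in> boundary_vertices G
             then (\<Sum>y\<in>neighbours G x. f $ y) / real (degree G x)
           else 0)"

definition neumann_laplacian :: "'v::finite pair_pre_digraph \<Rightarrow> real ^ 'v \<Rightarrow> real ^ 'v" where
  "neumann_laplacian G f =
     (\<chi> x. if x \<in> interior_vertices G then laplacian G (neumann_extension G f) $ x else 0)"

definition neumann_eigenspace :: "'v::finite pair_pre_digraph \<Rightarrow> real \<Rightarrow> (real ^ 'v) set" where
  "neumann_eigenspace G \<mu> =
     {f \<in> functions_on (interior_vertices G). neumann_laplacian G f = \<mu> *\<^sub>R f}"

definition neumann_spectrum :: "'v::finite pair_pre_digraph \<Rightarrow> real set" where
  "neumann_spectrum G = {\<mu>. \<exists>f\<in>neumann_eigenspace G \<mu>. f \<noteq> 0}"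

text \<open>
  The multiplicity of an eigenvalue is the dimension of its eigenspace; as the operator is
  self-adjoint, there is no difference to the algebraic multiplicity.
\<close>

definition neumann_eigenvalues :: "'v::finite pair_pre_digraph \<Rightarrow> real multiset" where
  "neumann_eigenvalues G =
     (\<Sum>\<mu>\<in>neumann_spectrum G. replicate_mset (dim (neumann_eigenspace G \<mu>)) \<mu>)"

text \<open>
  \<open>neumann_eigenvalue G i\<close> is the \<open>i\<close>-th smallest eigenvalue; the index starts at \<open>1\<close>.
\<close>

definition neumann_eigenvalue :: "'v::finite pair_pre_digraph \<Rightarrow> nat \<Rightarrow> real" where
  "neumann_eigenvalue G i = sorted_list_of_multiset (neumann_eigenvalues G) ! (i - 1)"

end

theory Submission
  imports Defs
begin

text \<open>
  The Neumann extension gives a boundary vertex the value of its only neighbour. The edges to the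
  boundary therefore contribute nothing to the Neumann Laplacian, which is the ordinary Laplacian
  \<open>L\<close> of the graph induced on the interior vertices (\<open>neumann_laplacian_interior\<close>). Both
  inequalities then come from test functions located at one edge of this interior graph.

  Take a longest path of the tree; it has at least three edges. Its second vertex \<open>x\<close> and its third
  vertex \<open>y\<close> are interior, and \<open>y\<close> is the only interior neighbour of \<open>x\<close>, since any other one would
  let the path grow (\<open>interior_leaf_exists\<close>). With \<open>e\<^sub>z\<close> the indicator function of a vertex \<open>z\<close> and
  \<open>1\<close> that of the whole interior, \<open>L e\<^sub>x = e\<^sub>x - e\<^sub>y\<close> and \<open>L 1 = 0\<close>. Consequently

  \<^item> every \<open>f = a 1 + b e\<^sub>x\<close> satisfies \<open>\<langle>L f, f\<rangle> = b\<^sup>2 \<le> 2 ((a + b)\<^sup>2 + a\<^sup>2) \<le> 2 \<langle>f, f\<rangle>\<close>, because \<open>f\<close>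
    takes the values \<open>a + b\<close> at \<open>x\<close> and \<open>a\<close> at \<open>y\<close>. This is a two-dimensional space of functions
    with Rayleigh quotient at most \<open>2\<close>, so at least two eigenvalues are at most \<open>2\<close>;

  \<^item> \<open>f = e\<^sub>x - e\<^sub>y\<close> has \<open>\<langle>L f, f\<rangle> = 3 + d \<ge> 4 = 2 \<langle>f, f\<rangle>\<close>, where \<open>d \<ge> 1\<close> is the number of interior
    neighbours of \<open>y\<close>, so some eigenvalue is at least \<open>2\<close>.

  The passage from Rayleigh quotients to the sorted list of eigenvalues uses an orthonormal basis of
  eigenvectors (\<open>symmetric_operator_has_orthonormal_eigenbasis\<close>), which identifies the multiset of
  eigenvalues, with multiplicities given by dimensions of eigenspaces, with the family of
  eigenvalues of the basis vectors (\<open>neumann_eigenvalues_eq_image\<close>).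
\<close>

section \<open>Symmetric operators on a subspace\<close>

text \<open>
  A maximiser \<open>v\<close> of the quadratic form \<open>\<langle>L x, x\<rangle>\<close> on the unit sphere of \<open>S\<close>, which exists by
  compactness, is an eigenvector: otherwise moving a little in the direction of the residual
  \<open>w = L v - \<mu> v\<close> would increase the Rayleigh quotient.
\<close>
lemma symmetric_operator_has_eigenvector:
  fixes L :: "'a::euclidean_space \<Rightarrow> 'a"
  assumes lin: "linear L" and S: "subspace S" "S \<noteq> {0}"
    and inv: "\<And>x. x \<in> S \<Longrightarrow> L x \<in> S"
    and sym: "\<And>x y. x \<in> S \<Longrightarrow> y \<in> S \<Longrightarrow> L x \<bullet> y = x \<bullet> L y"
  obtains v \<mu> where "v \<in> S" "norm v = 1" "L v = \<mu> *\<^sub>R v"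
proof -
  interpret linear L by (fact lin)
  let ?K = "S \<inter> sphere 0 1"
  have "compact ?K"
    using closed_subspace[OF S(1)] by (simp add: closed_Int_compact)
  moreover have "?K \<noteq> {}"
  proof -
    obtain x where x: "x \<in> S" "x \<noteq> 0"
      using S subspace_0[OF S(1)] by blast
    then have "(1 / norm x) *\<^sub>R x \<in> ?K"
      by (simp add: subspace_mul[OF S(1)])
    then show ?thesis by blast
  qed
  moreover have "continuous_on ?K (\<lambda>x. L x \<bullet> x)"
    by (intro continuous_intros linear_continuous_on linear_conv_bounded_linear[THEN iffD1] lin)
  ultimately obtain v where v: "v \<in> ?K" and v_max: "\<And>x. x \<in> ?K \<Longrightarrow> L x \<bullet> x \<le> L v \<bullet> v"
    by (metis (mono_tags, lifting) continuous_attains_sup)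
  define \<mu> where "\<mu> = L v \<bullet> v"
  have form_le: "L x \<bullet> x \<le> \<mu> * (x \<bullet> x)" if "x \<in> S" for x
  proof (cases "x = 0")
    case False
    have "(1 / norm x) *\<^sub>R x \<in> ?K"
      using that False by (simp add: subspace_mul[OF S(1)])
    from v_max[OF this] have "(L x \<bullet> x) / (norm x)\<^sup>2 \<le> \<mu>"
      by (simp add: scale \<mu>_def power2_eq_square)
    then show ?thesis
      using False by (simp add: divide_simps power2_norm_eq_inner split: if_splits)
  qed (simp add: zero)
  define w where "w = L v - \<mu> *\<^sub>R v"
  have vS: "v \<in> S" and vv: "v \<bullet> v = 1"
    using v by (auto simp: norm_eq_1)
  have wS: "w \<in> S"
    unfolding w_def by (intro subspace_diff subspace_mul inv vS S(1))
  define C where "C = \<mu> * (w \<bullet> w) - L w \<bullet> w"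
  \<comment> \<open>This is \<open>form_le\<close> at \<open>v + t w\<close>, whose terms of order zero in \<open>t\<close> cancel.\<close>
  have quadratic: "2 * t * (w \<bullet> w) \<le> t\<^sup>2 * C" for t
  proof -
    have "L (v + t *\<^sub>R w) \<bullet> (v + t *\<^sub>R w) \<le> \<mu> * ((v + t *\<^sub>R w) \<bullet> (v + t *\<^sub>R w))"
      by (intro form_le subspace_add subspace_mul vS wS S(1))
    moreover have "L w \<bullet> v = L v \<bullet> w"
      using sym[OF wS vS] by (simp add: inner_commute)
    moreover have "L v \<bullet> w = w \<bullet> w + \<mu> * (v \<bullet> w)"
      by (simp add: w_def inner_diff_left inner_diff_right inner_commute vv algebra_simps)
    ultimately show ?thesis
      by (simp add: add scale inner_add_left inner_add_right vv C_def power2_eq_square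
          inner_commute[of w v] algebra_simps flip: \<mu>_def)
  qed
  have "w = 0"
  proof (rule ccontr)
    assume "w \<noteq> 0"
    then have pos: "w \<bullet> w > 0" by simp
    \<comment> \<open>Small enough for the term of order \<open>t\<^sup>2\<close> to be dominated by the linear one.\<close>
    define t where "t = (w \<bullet> w) / (\<bar>C\<bar> + 1)"
    have "t > 0" using pos by (simp add: t_def)
    have "t * C \<le> t * \<bar>C\<bar>"
      using \<open>t > 0\<close> by (intro mult_left_mono) auto
    also have "\<dots> < t * (\<bar>C\<bar> + 1)"
      using \<open>t > 0\<close> by simp
    also have "\<dots> = w \<bullet> w"
      by (simp add: t_def)
    finally have "t * (t * C) < t * (w \<bullet> w)"
      using \<open>t > 0\<close> by simp
    moreover have "t * (w \<bullet> w) > 0" using \<open>t > 0\<close> pos by simp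
    ultimately show False
      using quadratic[of t] by (simp add: power2_eq_square algebra_simps)
  qed
  with vS v that show thesis by (simp add: w_def)
qed

locale orthonormal_eigenbasis =
  fixes S :: "'a::euclidean_space set" and L :: "'a \<Rightarrow> 'a"
    and B :: "'a set" and m :: "'a \<Rightarrow> real"
  assumes linear_L: "linear L"
    and orthogonal_B: "pairwise orthogonal B"
    and unit_B: "b \<in> B \<Longrightarrow> norm b = 1"
    and eigenvector_B: "b \<in> B \<Longrightarrow> L b = m b *\<^sub>R b"
    and span_B: "span B = S"

text \<open>
  Induction on the dimension: the orthogonal complement of an eigenvector within \<open>S\<close> is again
  invariant, by symmetry of the operator.
\<close>
theorem symmetric_operator_has_orthonormal_eigenbasis:
  fixes L :: "'a::euclidean_space \<Rightarrow> 'a"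
  assumes lin: "linear L" and S: "subspace S"
    and inv: "\<And>x. x \<in> S \<Longrightarrow> L x \<in> S"
    and sym: "\<And>x y. x \<in> S \<Longrightarrow> y \<in> S \<Longrightarrow> L x \<bullet> y = x \<bullet> L y"
  shows "\<exists>B m. orthonormal_eigenbasis S L B m"
  using S inv sym
proof (induction "dim S" arbitrary: S rule: less_induct)
  case less
  show ?case
  proof (cases "S = {0}")
    case True
    then have "orthonormal_eigenbasis S L {} (\<lambda>_. 0)"
      by (intro orthonormal_eigenbasis.intro) (auto simp: lin pairwise_def)
    then show ?thesis by blast
  next
    case False
    obtain v \<mu> where v: "v \<in> S" "norm v = 1" "L v = \<mu> *\<^sub>R v"
      using symmetric_operator_has_eigenvector[OF lin less.prems(1) False less.prems(2,3)] by blast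
    have vv: "v \<bullet> v = 1" using v by (simp add: norm_eq_1)
    define S' where "S' = {x \<in> S. x \<bullet> v = 0}"
    have sub: "subspace S'"
      using less.prems(1) by (auto simp: S'_def subspace_def inner_add_left)
    have inv': "L x \<in> S'" if "x \<in> S'" for x
      using that less.prems(2)[of x] less.prems(3)[of x v] v by (auto simp: S'_def)
    have "v \<notin> S'" using vv by (simp add: S'_def)
    moreover have "S' \<subseteq> S" by (auto simp: S'_def)
    ultimately have "S' \<subset> S" using v(1) by blast
    then have "dim S' < dim S"
      using sub less.prems(1) by (intro dim_psubset) (simp add: span_eq_iff[THEN iffD2])
    then obtain B m where "orthonormal_eigenbasis S' L B m"
      using less.hyps[OF _ sub inv'] less.prems(3) by (auto simp: S'_def)
    then interpret orthonormal_eigenbasis S' L B m .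
    have BS: "B \<subseteq> S'" using span_B span_superset by blast
    have "v \<notin> B" using BS vv by (auto simp: S'_def)
    have "orthonormal_eigenbasis S L (insert v B) (m(v := \<mu>))"
    proof (rule orthonormal_eigenbasis.intro)
      show "pairwise orthogonal (insert v B)"
        using orthogonal_B BS
        by (auto simp: pairwise_insert orthogonal_def S'_def inner_commute)
      show "span (insert v B) = S"
      proof
        show "span (insert v B) \<subseteq> S"
          using BS v(1) less.prems(1) by (intro span_minimal) (auto simp: S'_def)
        show "S \<subseteq> span (insert v B)"
        proof
          fix x assume "x \<in> S"
          then have "x - (x \<bullet> v) *\<^sub>R v \<in> S'"
            using v(1) vv less.prems(1)
            by (auto simp: S'_def inner_diff_left intro!: subspace_diff subspace_mul)
          then show "x \<in> span (insert v B)"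
            unfolding span_breakdown_eq span_B by blast
        qed
      qed
    qed (use v \<open>v \<notin> B\<close> lin unit_B eigenvector_B in auto)
    then show ?thesis by blast
  qed
qed

context orthonormal_eigenbasis
begin

sublocale linear L by (fact linear_L)

lemma independent_B: "independent B"
  using orthogonal_B unit_B by (intro pairwise_orthogonal_independent) force+

lemma finite_B: "finite B"
  using independent_B by (rule independent_imp_finite)

lemma card_B: "card B = dim S"
  using dim_span_eq_card_independent[OF independent_B] span_B by simp

lemma B_subset: "B \<subseteq> S"
  using span_B span_superset by blast

lemma expand: "x \<in> S \<Longrightarrow> (\<Sum>b\<in>B. (x \<bullet> b) *\<^sub>R b) = x"
  using orthonormal_basis_expand[OF orthogonal_B unit_B _ finite_B] span_B by blast

lemma inner_expand: "x \<in> S \<Longrightarrow> x \<bullet> y = (\<Sum>b\<in>B. (x \<bullet> b) * (b \<bullet> y))"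
  by (subst expand[symmetric]) (simp_all add: inner_sum_left)

lemma inner_operator: "x \<in> S \<Longrightarrow> L x \<bullet> y = (\<Sum>b\<in>B. m b * (x \<bullet> b) * (b \<bullet> y))"
  by (subst expand[symmetric])
    (simp_all add: inner_sum_left sum scale eigenvector_B mult.assoc mult.left_commute)

lemma inner_B: "a \<in> B \<Longrightarrow> b \<in> B \<Longrightarrow> a \<bullet> b = (if a = b then 1 else 0)"
  using orthogonal_B unit_B by (auto simp: pairwise_def orthogonal_def norm_eq_1)

lemma operator_coefficient:
  assumes "x \<in> S" "b \<in> B"
  shows "L x \<bullet> b = m b * (x \<bullet> b)"
proof -
  have "L x \<bullet> b = (\<Sum>a\<in>B. if a = b then m a * (x \<bullet> a) else 0)"
    unfolding inner_operator[OF assms(1)] by (intro sum.cong) (auto simp: inner_B assms(2))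
  then show ?thesis by (simp add: finite_B assms(2))
qed

text \<open>
  In eigencoordinates the form \<open>\<langle>L x, x\<rangle> - c \<langle>x, x\<rangle>\<close> is diagonal, so the comparison of a Rayleigh
  quotient with \<open>c\<close> becomes a question about the signs of the \<open>m b - c\<close>.
\<close>
lemma form_expand:
  assumes "x \<in> S"
  shows "(\<Sum>b\<in>B. (m b - c) * (x \<bullet> b)\<^sup>2) = L x \<bullet> x - c * (x \<bullet> x)"
proof -
  have "x \<bullet> x = (\<Sum>b\<in>B. (x \<bullet> b)\<^sup>2)"
    by (subst inner_expand[OF assms]) (simp add: power2_eq_square inner_commute)
  moreover have "L x \<bullet> x = (\<Sum>b\<in>B. m b * (x \<bullet> b)\<^sup>2)"
    by (subst inner_operator[OF assms]) (simp add: power2_eq_square inner_commute mult.assoc)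
  ultimately show ?thesis
    by (simp only: sum_distrib_left left_diff_distrib sum_subtractf)
qed

lemma eigenspace_eq_span: "{x \<in> S. L x = \<mu> *\<^sub>R x} = span {b \<in> B. m b = \<mu>}"
proof
  show "{x \<in> S. L x = \<mu> *\<^sub>R x} \<subseteq> span {b \<in> B. m b = \<mu>}"
  proof safe
    fix x assume x: "x \<in> S" "L x = \<mu> *\<^sub>R x"
    have "x \<bullet> b = 0" if "b \<in> B" "m b \<noteq> \<mu>" for b
      using operator_coefficient[OF x(1) that(1)] x(2) that(2) by auto
    then have "(\<Sum>b\<in>B. (x \<bullet> b) *\<^sub>R b) = (\<Sum>b\<in>{b \<in> B. m b = \<mu>}. (x \<bullet> b) *\<^sub>R b)"
      by (intro sum.mono_neutral_right) (auto simp: finite_B)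
    then have "x = (\<Sum>b\<in>{b \<in> B. m b = \<mu>}. (x \<bullet> b) *\<^sub>R b)"
      using expand[OF x(1)] by simp
    also have "\<dots> \<in> span {b \<in> B. m b = \<mu>}"
      by (intro span_sum span_scale span_base) auto
    finally show "x \<in> span {b \<in> B. m b = \<mu>}" .
  qed
  have "subspace {x \<in> S. L x = \<mu> *\<^sub>R x}"
    using subspace_span[of B] unfolding span_B subspace_def
    by (auto simp: zero add scale scaleR_add_right)
  then show "span {b \<in> B. m b = \<mu>} \<subseteq> {x \<in> S. L x = \<mu> *\<^sub>R x}"
    using B_subset eigenvector_B by (intro span_minimal) auto
qed

lemma dim_eigenspace: "dim {x \<in> S. L x = \<mu> *\<^sub>R x} = card {b \<in> B. m b = \<mu>}"
  unfolding eigenspace_eq_span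
  by (intro dim_span_eq_card_independent independent_mono[OF independent_B]) auto

lemma eigenvalue_iff: "(\<exists>x\<in>S. L x = \<mu> *\<^sub>R x \<and> x \<noteq> 0) \<longleftrightarrow> \<mu> \<in> m ` B"
proof
  assume "\<exists>x\<in>S. L x = \<mu> *\<^sub>R x \<and> x \<noteq> 0"
  then have "\<not> span {b \<in> B. m b = \<mu>} \<subseteq> {0}"
    using eigenspace_eq_span[of \<mu>] by blast
  then have "{b \<in> B. m b = \<mu>} \<noteq> {}" by (metis span_empty subset_refl)
  then show "\<mu> \<in> m ` B" by blast
next
  assume "\<mu> \<in> m ` B"
  then obtain b where b: "b \<in> B" "m b = \<mu>" by blast
  then have "b \<noteq> 0" using unit_B by fastforce
  then show "\<exists>x\<in>S. L x = \<mu> *\<^sub>R x \<and> x \<noteq> 0"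
    using b B_subset eigenvector_B by blast
qed

text \<open>
  One half of the Courant--Fischer principle. The projection \<open>P\<close> of \<open>V\<close> onto the span of the
  eigenvectors with eigenvalue at most \<open>c\<close> is injective: a vector in its kernel involves only
  eigenvalues above \<open>c\<close>, and then its Rayleigh quotient exceeds \<open>c\<close> unless it is zero.
\<close>
lemma dim_le_card_small_eigenvalues:
  assumes V: "subspace V" "V \<subseteq> S" and le: "\<And>x. x \<in> V \<Longrightarrow> L x \<bullet> x \<le> c * (x \<bullet> x)"
  shows "dim V \<le> card {b \<in> B. m b \<le> c}"
proof -
  let ?B = "{b \<in> B. m b \<le> c}"
  define P where "P x = (\<Sum>b\<in>?B. (x \<bullet> b) *\<^sub>R b)" for x
  have P: "linear P"
    unfolding P_def by (intro linearI) (simp_all add: inner_add_left scaleR_add_left sum.distrib scaleR_sum_right)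
  have "x = 0" if x: "x \<in> V" "P x = 0" for x
  proof -
    have small: "x \<bullet> b = 0" if b: "b \<in> ?B" for b
    proof -
      have "0 = P x \<bullet> b" by (simp add: x)
      also have "\<dots> = (\<Sum>a\<in>?B. if a = b then x \<bullet> a else 0)"
        using b unfolding P_def inner_sum_left by (intro sum.cong) (auto simp: inner_B)
      also have "\<dots> = x \<bullet> b" using b by (simp add: finite_B)
      finally show ?thesis by simp
    qed
    have xS: "x \<in> S" using x V by blast
    have "(\<Sum>b\<in>B. (m b - c) * (x \<bullet> b)\<^sup>2) \<le> 0"
      using le[OF x(1)] by (simp add: form_expand[OF xS])
    moreover have nonneg: "0 \<le> (m b - c) * (x \<bullet> b)\<^sup>2" if "b \<in> B" for b
      using small[of b] that by (cases "m b \<le> c") auto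
    ultimately have "(\<Sum>b\<in>B. (m b - c) * (x \<bullet> b)\<^sup>2) = 0"
      by (intro antisym sum_nonneg) auto
    then have "\<forall>b\<in>B. (m b - c) * (x \<bullet> b)\<^sup>2 = 0"
      using nonneg by (subst (asm) sum_nonneg_eq_0_iff) (auto simp: finite_B)
    then have "\<forall>b\<in>B. x \<bullet> b = 0" using small by fastforce
    then show "x = 0" using expand[OF xS] by simp
  qed
  then have "inj_on P (span V)"
    using V(1) by (simp add: linear_inj_on_iff_eq_0[OF P] span_eq_iff[THEN iffD2])
  then have "dim V = dim (P ` V)"
    using dim_image_eq[OF P] by simp
  also have "\<dots> \<le> card ?B"
  proof (rule dim_le_card)
    show "P ` V \<subseteq> span ?B"
      unfolding P_def by (intro image_subsetI span_sum span_scale span_base)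
  qed (simp add: finite_B)
  finally show ?thesis .
qed

lemma large_eigenvalue_exists:
  assumes x: "x \<in> S" "x \<noteq> 0" and ge: "c * (x \<bullet> x) \<le> L x \<bullet> x"
  shows "\<exists>b\<in>B. c \<le> m b"
proof (rule ccontr)
  assume "\<not> ?thesis"
  then have less: "m b < c" if "b \<in> B" for b using that by auto
  have "(\<Sum>b\<in>B. (c - m b) * (x \<bullet> b)\<^sup>2) = - (\<Sum>b\<in>B. (m b - c) * (x \<bullet> b)\<^sup>2)"
    by (simp add: algebra_simps flip: sum_negf)
  then have "(\<Sum>b\<in>B. (c - m b) * (x \<bullet> b)\<^sup>2) \<le> 0"
    using ge by (simp add: form_expand[OF x(1)])
  moreover have nonneg: "0 \<le> (c - m b) * (x \<bullet> b)\<^sup>2" if "b \<in> B" for b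
    using less[OF that] by simp
  ultimately have "(\<Sum>b\<in>B. (c - m b) * (x \<bullet> b)\<^sup>2) = 0"
    by (intro antisym sum_nonneg) auto
  then have "\<forall>b\<in>B. (c - m b) * (x \<bullet> b)\<^sup>2 = 0"
    using nonneg by (subst (asm) sum_nonneg_eq_0_iff) (auto simp: finite_B)
  then have "\<forall>b\<in>B. x \<bullet> b = 0" using less by fastforce
  then show False using expand[OF x(1)] x(2) by simp
qed

end

section \<open>Entries of a sorted list of eigenvalues\<close>

lemma sorted_nth_le:
  assumes "sorted xs" "j < length (filter (\<lambda>x. x \<le> c) xs)"
  shows "xs ! j \<le> (c :: 'a::linorder)"
  using assms
proof (induction xs arbitrary: j)
  case (Cons x xs)
  show ?case
  proof (cases "x \<le> c")
    case True
    then show ?thesis using Cons by (cases j) auto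
  next
    case False
    then have "filter (\<lambda>x. x \<le> c) xs = []"
      using Cons.prems(1) by (auto simp: filter_empty_conv)
    then show ?thesis using Cons.prems(2) False by simp
  qed
qed simp

lemma sorted_list_of_multiset_nth_le:
  assumes "j < size (filter_mset (\<lambda>x. x \<le> c) M)"
  shows "sorted_list_of_multiset M ! j \<le> (c :: 'a::linorder)"
proof (rule sorted_nth_le)
  show "j < length (filter (\<lambda>x. x \<le> c) (sorted_list_of_multiset M))"
    using assms by (metis mset_filter mset_sorted_list_of_multiset size_mset)
qed simp

lemma sorted_list_of_multiset_last_ge:
  assumes "x \<in># M" "(c :: 'a::linorder) \<le> x"
  shows "c \<le> sorted_list_of_multiset M ! (size M - 1)"
proof -
  let ?xs = "sorted_list_of_multiset M"
  have len: "length ?xs = size M"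
    by (metis mset_sorted_list_of_multiset size_mset)
  obtain i where i: "i < length ?xs" "?xs ! i = x"
    using assms(1) by (metis in_set_conv_nth set_sorted_list_of_multiset)
  then have "?xs ! i \<le> ?xs ! (size M - 1)"
    using len by (intro sorted_nth_mono) auto
  with i assms(2) show ?thesis by simp
qed

text \<open>
  The right-hand side has the shape of the definition of the Neumann eigenvalues, once the dimension
  of each eigenspace is known to be the number of basis vectors in it.
\<close>
lemma image_mset_mset_set_eq_sum_replicate:
  assumes "finite B"
  shows "image_mset m (mset_set B) = (\<Sum>\<mu>\<in>m ` B. replicate_mset (card {b \<in> B. m b = \<mu>}) \<mu>)"
proof (rule multiset_eqI)
  fix x
  have "count (image_mset m (mset_set B)) x = (\<Sum>b | b \<in> B \<and> x = m b. count (mset_set B) b)"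
    using assms by (simp add: count_image_mset')
  also have "\<dots> = (\<Sum>b | b \<in> B \<and> x = m b. 1)"
    using assms by (intro sum.cong) auto
  also have "\<dots> = card {b \<in> B. m b = x}"
    by (simp add: eq_commute)
  also have "\<dots> = (\<Sum>\<mu>\<in>m ` B. if \<mu> = x then card {b \<in> B. m b = x} else 0)"
  proof (cases "x \<in> m ` B")
    case False
    then have "{b \<in> B. m b = x} = {}" by auto
    with False assms show ?thesis by simp
  qed (use assms in simp)
  also have "\<dots> = count (\<Sum>\<mu>\<in>m ` B. replicate_mset (card {b \<in> B. m b = \<mu>}) \<mu>) x"
    unfolding count_sum by (intro sum.cong) auto
  finally show "count (image_mset m (mset_set B)) x
    = count (\<Sum>\<mu>\<in>m ` B. replicate_mset (card {b \<in> B. m b = \<mu>}) \<mu>) x" .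
qed

section \<open>Paths in trees\<close>

context pair_graph
begin

text \<open>
  In a graph without cycles, a path can be prolonged by any edge at its first vertex other than its
  own first edge: if the new vertex \<open>c\<close> were already on the path, the part of the path from \<open>a\<close> to
  \<open>c\<close> would have at least two arcs and would form a cycle together with the new one.
\<close>
lemma apath_extend:
  assumes acyclic: "\<not> (\<exists>p. cycle p \<and> 3 \<le> length p)"
    and path: "apath a ((a, a') # p) b" and arc: "(c, a) \<in> parcs G" and "c \<noteq> a'"
  shows "apath c ((c, a) # (a, a') # p) b"
proof -
  let ?P = "(a, a') # p"
  have "c \<notin> set (pawalk_verts a ?P)"
  proof
    assume "c \<in> set (pawalk_verts a ?P)"
    then obtain q r where q: "?P = q @ r" "awalk a q c"
      using awalk_decomp[OF awalkI_apath[OF path]] by blast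
    have "c \<noteq> a" using no_loops'[OF arc] .
    then have "q \<noteq> []" using q(2) by (auto simp: awalk_Nil_iff)
    then obtain q' where q': "q = (a, a') # q'" using q(1) by (cases q) auto
    have "q' \<noteq> []" using q(2) \<open>c \<noteq> a'\<close> by (auto simp: q' awalk_Cons_iff awalk_Nil_iff)
    have "distinct (pawalk_verts a q)"
      using path unfolding q(1) apath_append_iff by (simp add: apath_def)
    then have "cycle ((c, a) # q)"
      using q(2) arc in_arcsD1[OF arc]
      unfolding cycle_def by (intro exI[of _ c]) (auto simp: awalk_Cons_iff)
    moreover have "3 \<le> length ((c, a) # q)"
      using \<open>q' \<noteq> []\<close> by (cases q') (auto simp: q')
    ultimately show False using acyclic by blast
  qed
  then show ?thesis using path arc by (simp add: apath_Cons_iff)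
qed

lemma finite_neighbours: "finite (neighbours G x)"
  by (rule finite_subset[of _ "snd ` parcs G"]) (auto simp: neighbours_def pair_finite_arcs image_iff Bex_def)

lemma degree_eq_card_neighbours: "degree G x = card (neighbours G x)"
proof -
  have "out_arcs (with_proj G) x = Pair x ` neighbours G x"
    by (auto simp: out_arcs_def neighbours_def)
  then show ?thesis
    by (simp add: degree_def out_degree_def card_image inj_on_def)
qed

lemma interior_if_two_neighbours:
  assumes "(x, y) \<in> parcs G" "(x, z) \<in> parcs G" "y \<noteq> z"
  shows "x \<in> interior_vertices G"
proof -
  have "neighbours G x \<noteq> {w}" for w
  proof
    assume "neighbours G x = {w}"
    moreover have "y \<in> neighbours G x" "z \<in> neighbours G x"
      using assms by (simp_all add: neighbours_def)
    ultimately show False using assms(3) by simp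
  qed
  then have "degree G x \<noteq> 1"
    by (simp add: degree_eq_card_neighbours card_1_singleton_iff)
  then show ?thesis
    using in_arcsD1[OF assms(1)] by (simp add: interior_vertices_def boundary_vertices_def)
qed

lemma neighbours_boundary:
  assumes "y \<in> boundary_vertices G" "(x, y) \<in> parcs G"
  shows "neighbours G y = {x}"
proof -
  have "x \<in> neighbours G y" using assms(2) by (auto simp: neighbours_def arcs_symmetric)
  then show ?thesis
    using assms(1) by (auto simp: boundary_vertices_def degree_eq_card_neighbours card_1_singleton_iff)
qed

text \<open>
  Let \<open>u, v1, v2, v3\<close> be the first vertices of a longest path. For a neighbour \<open>z \<noteq> v2\<close> of \<open>v1\<close>, the
  path \<open>z, v1, v2, \<dots>\<close> is a longest path as well, and hence cannot be prolonged at \<open>z\<close>; thus \<open>z\<close> has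
  degree one. Since \<open>v2\<close> has the two neighbours \<open>v1\<close> and \<open>v3\<close>, it is the only interior neighbour of
  \<open>v1\<close>. The vertex \<open>v3\<close> is where three arcs are needed.
\<close>
lemma interior_leaf_exists:
  assumes acyclic: "\<not> (\<exists>p. cycle p \<and> 3 \<le> length p)"
    and long: "apath u0 p0 w0" "3 \<le> length p0"
  obtains x y where "x \<in> interior_vertices G" "y \<in> interior_vertices G"
    "neighbours G x \<inter> interior_vertices G = {y}"
proof -
  define Q where "Q n \<longleftrightarrow> (\<exists>u p w. apath u p w \<and> length p = n)" for n
  have "Q (length p0)" using long(1) by (auto simp: Q_def)
  moreover have bound: "n \<le> card (pverts G)" if "Q n" for n
    using that length_apath by (auto simp: Q_def)
  ultimately have "Q (Greatest Q)" "length p0 \<le> Greatest Q"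
    by (blast intro: GreatestI_nat Greatest_le_nat)+
  then obtain u p w where p: "apath u p w" "length p = Greatest Q"
    by (auto simp: Q_def)
  have longest: "length q \<le> length p" if "apath u' q w'" for u' q w'
  proof -
    have "Q (length q)" using that by (auto simp: Q_def)
    then show ?thesis using Greatest_le_nat[of Q] bound p(2) by metis
  qed
  have "3 \<le> length p" using long(2) \<open>length p0 \<le> Greatest Q\<close> p(2) by simp
  then obtain e1 e2 e3 r where pe: "p = e1 # e2 # e3 # r"
    by (auto simp: numeral_3_eq_3 Suc_le_length_iff)
  define v1 v2 v3 where "v1 = snd e1" and "v2 = snd e2" and "v3 = snd e3"
  have e: "e1 = (u, v1)" "e2 = (v1, v2)" "e3 = (v2, v3)"
    using p(1) by (auto simp: pe apath_Cons_iff v1_def v2_def v3_def prod_eq_iff)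
  have path1: "apath v1 ((v1, v2) # e3 # r) w"
    using p(1) by (simp add: pe e apath_Cons_iff)
  have arcs: "(u, v1) \<in> parcs G" "(v1, v2) \<in> parcs G" "(v2, v3) \<in> parcs G"
    and "u \<noteq> v2" "v1 \<noteq> v3"
    using p(1) hd_in_awalk_verts(2)[of v3 r w] by (auto simp: pe e apath_Cons_iff)
  note arcs_rev = arcs[THEN arcs_symmetric]
  have v1: "v1 \<in> interior_vertices G"
    using interior_if_two_neighbours[OF arcs_rev(1) arcs(2) \<open>u \<noteq> v2\<close>] .
  have v2: "v2 \<in> interior_vertices G"
    using interior_if_two_neighbours[OF arcs_rev(2) arcs(3) \<open>v1 \<noteq> v3\<close>] .
  have "z = v2" if z: "(v1, z) \<in> parcs G" "z \<in> interior_vertices G" for z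
  proof (rule ccontr)
    assume "z \<noteq> v2"
    have zv: "(z, v1) \<in> parcs G" using z(1) by (rule arcs_symmetric)
    have path2: "apath z ((z, v1) # (v1, v2) # e3 # r) w"
      using apath_extend[OF acyclic path1 zv \<open>z \<noteq> v2\<close>] .
    have "z' = v1" if "(z, z') \<in> parcs G" for z'
    proof (rule ccontr)
      assume "z' \<noteq> v1"
      from longest[OF apath_extend[OF acyclic path2 arcs_symmetric[OF that] this]]
      show False by (simp add: pe)
    qed
    then have "neighbours G z = {v1}" using zv unfolding neighbours_def by blast
    then show False
      using z(2) by (simp add: interior_vertices_def boundary_vertices_def degree_eq_card_neighbours)
  qed
  then have "neighbours G v1 \<inter> interior_vertices G = {v2}"
    using arcs(2) v2 unfolding neighbours_def by blast
  with v1 v2 show thesis by (rule that)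
qed

text \<open>
  If no path had more than two arcs, any two vertices would be joined by a path of cost at most \<open>2\<close>.
\<close>
lemma long_path_exists:
  assumes conn: "Digraph_Component.connected (with_proj G)" and diam: "3 \<le> graph_diameter G"
  obtains u p w where "apath u p w" "3 \<le> length p"
proof (rule ccontr)
  assume "\<not> thesis"
  with that have short: "length p \<le> 2" if "apath u p w" for u p w
    using that by fastforce
  have "graph_distance G u w \<le> 2" if uw: "u \<in> pverts G" "w \<in> pverts G" for u w
  proof -
    have "strongly_connected (with_proj G)"
      using symmetric_connected_imp_strongly_connected[OF pair_sym_arcs conn] .
    then have "u \<rightarrow>\<^sup>*\<^bsub>with_proj G\<^esub> w"
      using uw unfolding strongly_connected_def with_proj_simps by blast
    then obtain p where p: "apath u p w"
      using reachable_apath by blast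
    have "graph_distance G u w \<le> awalk_cost (\<lambda>_. 1) p"
      unfolding graph_distance_def by (rule min_cost_le_walk_cost[OF awalkI_apath[OF p]])
    also have "awalk_cost (\<lambda>_. 1) p = length p"
      by (induction p) auto
    also have "ereal (length p) \<le> 2"
      using short[OF p] by simp
    finally show ?thesis .
  qed
  then have "graph_diameter G \<le> 2"
    unfolding graph_diameter_def by (intro SUP_least)
  with diam have "3 \<le> (2 :: ereal)" by (rule order_trans)
  then show False by simp
qed

section \<open>The Neumann Laplacian as the Laplacian of the interior\<close>

end

section \<open>The Neumann Laplacian as the Laplacian of the interior graph\<close>

abbreviation interior_neighbours :: "'v pair_pre_digraph \<Rightarrow> 'v \<Rightarrow> 'v set" where
  "interior_neighbours G x \<equiv> neighbours G x \<inter> interior_vertices G"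

text \<open>
  The extension of \<open>f\<close> to a boundary vertex \<open>y\<close> adjacent to \<open>x\<close> averages over the single neighbour
  \<open>x\<close>, so the edge from \<open>x\<close> to \<open>y\<close> contributes \<open>f(x) - f(x) = 0\<close>.
\<close>
lemma neumann_laplacian_interior:
  assumes "pair_graph G" and x: "x \<in> interior_vertices G"
  shows "neumann_laplacian G f $ x = (\<Sum>y\<in>interior_neighbours G x. f $ x - f $ y)"
proof -
  interpret pair_graph G by fact
  have "neumann_extension G f $ y = f $ x"
    if y: "y \<in> neighbours G x" "y \<notin> interior_vertices G" for y
  proof -
    have arc: "(x, y) \<in> parcs G" using y(1) by (simp add: neighbours_def)
    then have "y \<in> boundary_vertices G"
      using y(2) in_arcsD2 by (auto simp: interior_vertices_def)
    then show ?thesis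
      using y(2) neighbours_boundary[OF _ arc]
      by (simp add: neumann_extension_def degree_eq_card_neighbours)
  qed
  moreover have "neumann_laplacian G f $ x
    = (\<Sum>y\<in>neighbours G x. f $ x - neumann_extension G f $ y)"
    using x by (simp add: neumann_laplacian_def laplacian_def neumann_extension_def)
  ultimately have "neumann_laplacian G f $ x
    = (\<Sum>y\<in>interior_neighbours G x. f $ x - neumann_extension G f $ y)"
    by (simp only:) (intro sum.mono_neutral_right, auto simp: finite_neighbours)
  also have "\<dots> = (\<Sum>y\<in>interior_neighbours G x. f $ x - f $ y)"
    by (intro sum.cong) (auto simp: neumann_extension_def)
  finally show ?thesis .
qed

lemma neumann_laplacian_outside: "x \<notin> interior_vertices G \<Longrightarrow> neumann_laplacian G f $ x = 0"
  by (simp add: neumann_laplacian_def)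

lemma linear_neumann_laplacian:
  assumes "pair_graph G"
  shows "linear (neumann_laplacian G)"
proof (rule linearI)
  fix f g c
  show "neumann_laplacian G (f + g) = neumann_laplacian G f + neumann_laplacian G g"
  proof (rule vec_eq_iff[THEN iffD2], rule allI)
    fix x show "neumann_laplacian G (f + g) $ x = (neumann_laplacian G f + neumann_laplacian G g) $ x"
      by (cases "x \<in> interior_vertices G")
        (simp_all add: neumann_laplacian_interior[OF assms] neumann_laplacian_outside
          algebra_simps flip: sum.distrib)
  qed
  show "neumann_laplacian G (c *\<^sub>R f) = c *\<^sub>R neumann_laplacian G f"
  proof (rule vec_eq_iff[THEN iffD2], rule allI)
    fix x show "neumann_laplacian G (c *\<^sub>R f) $ x = (c *\<^sub>R neumann_laplacian G f) $ x"
      by (cases "x \<in> interior_vertices G")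
        (simp_all add: neumann_laplacian_interior[OF assms] neumann_laplacian_outside
          sum_distrib_left right_diff_distrib)
  qed
qed

text \<open>
  The adjacency matrix \<open>a\<close> of the interior graph is symmetric. In \<open>\<langle>L f, g\<rangle> - \<langle>f, L g\<rangle>\<close> the diagonal
  terms \<open>f(x) g(x)\<close> cancel, and the two remaining double sums agree after exchanging the summation
  variables.
\<close>
lemma neumann_laplacian_symmetric:
  assumes "pair_graph G"
  shows "neumann_laplacian G f \<bullet> g = f \<bullet> neumann_laplacian G g"
proof -
  interpret pair_graph G by fact
  define a :: "'a \<Rightarrow> 'a \<Rightarrow> real"
    where "a x y = of_bool (x \<in> interior_vertices G \<and> y \<in> interior_neighbours G x)" for x y
  have a_sym: "a x y = a y x" for x y
    by (auto simp: a_def neighbours_def arcs_symmetric)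
  have nth: "neumann_laplacian G f $ x = (\<Sum>y\<in>UNIV. a x y * (f $ x - f $ y))" for f x
  proof (cases "x \<in> interior_vertices G")
    case True
    have "(\<Sum>y\<in>interior_neighbours G x. f $ x - f $ y)
      = (\<Sum>y\<in>UNIV. if y \<in> interior_neighbours G x then f $ x - f $ y else 0)"
      by (intro sum.mono_neutral_cong_left) auto
    also have "\<dots> = (\<Sum>y\<in>UNIV. a x y * (f $ x - f $ y))"
      using True by (intro sum.cong) (auto simp: a_def)
    finally show ?thesis
      using neumann_laplacian_interior[OF assms True] by metis
  qed (simp add: neumann_laplacian_outside a_def)
  have "neumann_laplacian G f \<bullet> g - f \<bullet> neumann_laplacian G g
    = (\<Sum>x\<in>UNIV. \<Sum>y\<in>UNIV. a x y * (f $ x * g $ y)) - (\<Sum>x\<in>UNIV. \<Sum>y\<in>UNIV. a x y * (f $ y * g $ x))"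
    by (simp add: inner_vec_def nth sum_distrib_left sum_distrib_right algebra_simps
        flip: sum_subtractf)
  also have "(\<Sum>x\<in>UNIV. \<Sum>y\<in>UNIV. a x y * (f $ y * g $ x)) = (\<Sum>x\<in>UNIV. \<Sum>y\<in>UNIV. a x y * (f $ x * g $ y))"
    by (subst sum.swap) (simp add: a_sym)
  finally show ?thesis by simp
qed

lemma subspace_functions_on: "subspace (functions_on S)"
  by (auto simp: functions_on_def subspace_def)

lemma dim_functions_on: "dim (functions_on S :: (real ^ 'v::finite) set) = card S"
proof -
  have "functions_on S = {f :: real ^ 'v. \<forall>i. i \<notin> S \<longrightarrow> f $ i = 0}"
    by (simp add: functions_on_def)
  then show ?thesis
    using dim_substandard_cart[where 'a = real and d = S] by (simp add: dim_vec_eq)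
qed

lemma neumann_eigenbasis_exists:
  assumes "pair_graph G"
  obtains B m where "orthonormal_eigenbasis (functions_on (interior_vertices G)) (neumann_laplacian G) B m"
proof -
  have "neumann_laplacian G f \<in> functions_on (interior_vertices G)" for f
    by (simp add: functions_on_def neumann_laplacian_outside)
  with symmetric_operator_has_orthonormal_eigenbasis[OF linear_neumann_laplacian[OF assms]
      subspace_functions_on _ neumann_laplacian_symmetric[OF assms]] that
  show thesis by blast
qed

lemma neumann_eigenvalues_eq_image:
  assumes "orthonormal_eigenbasis (functions_on (interior_vertices G)) (neumann_laplacian G) B m"
  shows "neumann_eigenvalues G = image_mset m (mset_set B)"
proof -
  interpret orthonormal_eigenbasis "functions_on (interior_vertices G)" "neumann_laplacian G" B m
    by fact
  have "neumann_spectrum G = m ` B"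
    using eigenvalue_iff by (auto simp: neumann_spectrum_def neumann_eigenspace_def)
  then show ?thesis
    unfolding neumann_eigenvalues_def neumann_eigenspace_def
    by (simp add: dim_eigenspace image_mset_mset_set_eq_sum_replicate[OF finite_B])
qed

text \<open>
  The two variational bounds for the sorted eigenvalues: a subspace with small Rayleigh quotients
  bounds an eigenvalue from above by counting, and a single test function bounds the largest one
  from below.
\<close>
theorem neumann_eigenvalue_le:
  assumes G: "pair_graph G"
    and V: "subspace V" "V \<subseteq> functions_on (interior_vertices G)"
    and le: "\<And>f. f \<in> V \<Longrightarrow> neumann_laplacian G f \<bullet> f \<le> c * (f \<bullet> f)"
    and i: "1 \<le> i" "i \<le> dim V"
  shows "neumann_eigenvalue G i \<le> c"
proof -
  obtain B m where "orthonormal_eigenbasis (functions_on (interior_vertices G)) (neumann_laplacian G) B m"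
    using neumann_eigenbasis_exists[OF G] .
  then interpret orthonormal_eigenbasis "functions_on (interior_vertices G)" "neumann_laplacian G" B m .
  have "i - 1 < card {b \<in> B. m b \<le> c}"
    using dim_le_card_small_eigenvalues[OF V le] i by simp
  also have "\<dots> = size (filter_mset (\<lambda>x. x \<le> c) (neumann_eigenvalues G))"
    by (simp add: neumann_eigenvalues_eq_image[OF orthonormal_eigenbasis_axioms]
        filter_mset_image_mset finite_B)
  finally show ?thesis
    unfolding neumann_eigenvalue_def by (rule sorted_list_of_multiset_nth_le)
qed

theorem neumann_eigenvalue_last_ge:
  assumes G: "pair_graph G"
    and f: "f \<in> functions_on (interior_vertices G)" "f \<noteq> 0"
    and ge: "c * (f \<bullet> f) \<le> neumann_laplacian G f \<bullet> f"
  shows "c \<le> neumann_eigenvalue G (card (interior_vertices G))"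
proof -
  obtain B m where "orthonormal_eigenbasis (functions_on (interior_vertices G)) (neumann_laplacian G) B m"
    using neumann_eigenbasis_exists[OF G] .
  then interpret orthonormal_eigenbasis "functions_on (interior_vertices G)" "neumann_laplacian G" B m .
  note eq = neumann_eigenvalues_eq_image[OF orthonormal_eigenbasis_axioms]
  have "size (neumann_eigenvalues G) = card (interior_vertices G)"
    by (simp add: eq card_B dim_functions_on)
  moreover obtain b where "b \<in> B" "c \<le> m b"
    using large_eigenvalue_exists[OF f ge] by blast
  ultimately show ?thesis
    using sorted_list_of_multiset_last_ge[of "m b" "neumann_eigenvalues G" c]
    by (simp add: neumann_eigenvalue_def eq finite_B)
qed

section \<open>Test functions at a leaf of the interior\<close>

lemma neumann_laplacian_const:
  assumes "pair_graph G"
  shows "neumann_laplacian G (\<chi> z. if z \<in> interior_vertices G then 1 else 0) = 0"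
proof (rule vec_eq_iff[THEN iffD2], rule allI)
  fix z show "neumann_laplacian G (\<chi> z. if z \<in> interior_vertices G then 1 else 0) $ z = 0 $ z"
    by (cases "z \<in> interior_vertices G")
      (simp_all add: neumann_laplacian_interior[OF assms] neumann_laplacian_outside)
qed

context
  fixes G :: "'v::finite pair_pre_digraph" and x y :: 'v
  assumes G: "pair_graph G"
    and x: "x \<in> interior_vertices G" and y: "y \<in> interior_vertices G"
    and leaf: "interior_neighbours G x = {y}"
begin

interpretation pair_graph G by (fact G)

lemma leaf_neq: "x \<noteq> y"
  using leaf no_loops'[of x y] by (auto simp: neighbours_def)

text \<open>
  Away from \<open>x\<close> the indicator function of \<open>x\<close> is seen only by the vertices that have \<open>x\<close> as an interior
  neighbour, and by symmetry of adjacency \<open>y\<close> is the only such interior vertex.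
\<close>
lemma neumann_laplacian_axis_leaf:
  "neumann_laplacian G (axis x 1) = axis x 1 - axis y 1"
proof (rule vec_eq_iff[THEN iffD2], rule allI)
  fix z
  consider "z \<notin> interior_vertices G" | "z = x" | "z \<in> interior_vertices G" "z \<noteq> x" by blast
  then show "neumann_laplacian G (axis x 1) $ z = (axis x 1 - axis y 1) $ z"
  proof cases
    case 1
    then show ?thesis using x y by (auto simp: neumann_laplacian_outside axis_def)
  next
    case 2
    then show ?thesis
      using x leaf leaf_neq by (simp add: neumann_laplacian_interior[OF G] axis_def)
  next
    case 3
    have "x \<in> neighbours G z \<longleftrightarrow> z = y"
      using leaf 3(1) arcs_symmetric by (auto simp: neighbours_def)
    moreover have "(\<Sum>w\<in>interior_neighbours G z. axis x 1 $ z - axis x 1 $ w)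
      = (\<Sum>w\<in>interior_neighbours G z. if w = x then - 1 else 0 :: real)"
      using 3(2) by (intro sum.cong) (auto simp: axis_def)
    ultimately show ?thesis
      using 3 x by (simp add: neumann_laplacian_interior[OF G] finite_neighbours axis_def)
  qed
qed

text \<open>
  The test space is spanned by the constants and the indicator function of \<open>x\<close>. The bound
  \<open>b\<^sup>2 \<le> 2 ((a + b)\<^sup>2 + a\<^sup>2)\<close> rests on \<open>(2 a + b)\<^sup>2 \<ge> 0\<close>.
\<close>
lemma second_neumann_eigenvalue_le_2: "neumann_eigenvalue G 2 \<le> 2"
proof (rule neumann_eigenvalue_le[OF G subspace_span])
  define one :: "real ^ 'v" where "one = (\<chi> z. if z \<in> interior_vertices G then 1 else 0)"
  let ?e = "axis x 1 :: real ^ 'v"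
  have one_nth: "one $ x = 1" "one $ y = 1" using x y by (simp_all add: one_def)
  have e_nth: "?e $ x = 1" "?e $ y = 0" using leaf_neq by (simp_all add: axis_def)
  interpret linear "neumann_laplacian G" by (rule linear_neumann_laplacian[OF G])
  show "span {?e, one} \<subseteq> functions_on (interior_vertices G)"
    using x by (intro span_minimal subspace_functions_on) (auto simp: functions_on_def axis_def one_def)
  have "one \<noteq> 0" using one_nth by auto
  moreover have "?e \<notin> span {one}"
    using one_nth e_nth leaf_neq by (auto simp: span_singleton)
  ultimately have "independent {?e, one}" by (simp add: independent_insert)
  moreover have "?e \<noteq> one"
  proof
    assume "?e = one"
    then show False using one_nth(2) e_nth(2) by simp
  qed
  ultimately show "2 \<le> dim (span {?e, one})"
    using dim_span_eq_card_independent by fastforce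
  fix f assume "f \<in> span {?e, one}"
  then obtain a b where f: "f = a *\<^sub>R one + b *\<^sub>R ?e"
    by (auto simp: span_breakdown_eq span_singleton algebra_simps)
  have Lf: "neumann_laplacian G f = b *\<^sub>R (?e - axis y 1)"
    using neumann_laplacian_const[OF G]
    by (simp add: f add scale neumann_laplacian_axis_leaf flip: one_def)
  have "neumann_laplacian G f \<bullet> f = b * (f $ x - f $ y)"
    by (simp add: Lf inner_diff_left inner_axis' )
  also have "\<dots> = b\<^sup>2"
    by (simp add: f one_nth e_nth power2_eq_square)
  also have "\<dots> \<le> 2 * ((a + b)\<^sup>2 + a\<^sup>2)"
    using zero_le_power2[of "2 * a + b"] by (simp add: power2_eq_square algebra_simps)
  also have "(a + b)\<^sup>2 + a\<^sup>2 = (\<Sum>z\<in>{x, y}. f $ z * f $ z)"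
    using leaf_neq by (simp add: f one_nth e_nth power2_eq_square)
  also have "\<dots> \<le> f \<bullet> f"
    unfolding inner_vec_def inner_real_def by (intro sum_mono2) auto
  finally show "neumann_laplacian G f \<bullet> f \<le> 2 * (f \<bullet> f)" by simp
qed simp

text \<open>
  The difference of the two indicator functions is large across the edge from \<open>x\<close> to \<open>y\<close>: this
  edge alone gives \<open>(1 - (-1))\<^sup>2 = 4\<close>, twice the squared norm.
\<close>
lemma largest_neumann_eigenvalue_ge_2: "2 \<le> neumann_eigenvalue G (card (interior_vertices G))"
proof (rule neumann_eigenvalue_last_ge[OF G])
  let ?f = "axis x 1 - axis y 1 :: real ^ 'v"
  interpret linear "neumann_laplacian G" by (rule linear_neumann_laplacian[OF G])
  show "?f \<in> functions_on (interior_vertices G)"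
    using x y by (auto simp: functions_on_def axis_def)
  have axis_nth: "axis x 1 $ y = (0 :: real)" "axis y 1 $ x = (0 :: real)"
    "axis x 1 $ x = (1 :: real)" "axis y 1 $ y = (1 :: real)"
    using leaf_neq by (simp_all add: axis_def)
  have f_nth: "?f $ x = 1" "?f $ y = - 1" using leaf_neq by (simp_all add: axis_def)
  then show "?f \<noteq> 0" by (metis zero_index zero_neq_one)
  have "x \<in> interior_neighbours G y"
    using x leaf arcs_symmetric by (auto simp: neighbours_def)
  then have "card (interior_neighbours G y) \<ge> 1"
    by (metis One_nat_def Suc_leI card_gt_0_iff empty_iff finite)
  moreover have "neumann_laplacian G (axis y 1) $ y = card (interior_neighbours G y)"
  proof -
    have "y \<notin> neighbours G y" using no_loops'[of y y] by (auto simp: neighbours_def)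
    then have "(\<Sum>w\<in>interior_neighbours G y. axis y 1 $ y - axis y 1 $ w)
      = (\<Sum>w\<in>interior_neighbours G y. 1 :: real)"
      by (intro sum.cong) (auto simp: axis_def)
    then show ?thesis by (simp add: neumann_laplacian_interior[OF G y])
  qed
  moreover have "neumann_laplacian G (axis y 1) $ x = - 1"
    using leaf leaf_neq by (simp add: neumann_laplacian_interior[OF G x] axis_def)
  moreover have "neumann_laplacian G ?f \<bullet> ?f = neumann_laplacian G ?f $ x - neumann_laplacian G ?f $ y"
    by (simp add: inner_diff_right inner_axis)
  ultimately have "4 \<le> neumann_laplacian G ?f \<bullet> ?f"
    by (simp add: diff neumann_laplacian_axis_leaf axis_nth)
  moreover have "?f \<bullet> ?f = 2"
    using f_nth by (simp add: inner_diff_right inner_axis)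
  ultimately show "2 * (?f \<bullet> ?f) \<le> neumann_laplacian G ?f \<bullet> ?f" by simp
qed

end

theorem corollary1p1:
  fixes T :: "'v::finite pair_pre_digraph" and k :: nat
  assumes "undirected_tree T"
    and "3 \<le> card (pverts T)"
    and "card (interior_vertices T) = k"
    and "3 \<le> graph_diameter T"
  shows "neumann_eigenvalue T 2 \<le> 2 \<and> 2 \<le> neumann_eigenvalue T k"
proof -
  have G: "pair_graph T" and conn: "Digraph_Component.connected (with_proj T)"
    and acyclic: "\<not> (\<exists>p. pre_digraph.cycle (with_proj T) p \<and> 3 \<le> length p)"
    using assms(1) by (auto simp: undirected_tree_def)
  interpret pair_graph T by (fact G)
  obtain u p w where "apath u p w" "3 \<le> length p"
    using long_path_exists[OF conn assms(4)] .
  with acyclic obtain x y where "x \<in> interior_vertices T" "y \<in> interior_vertices T"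
    "interior_neighbours T x = {y}"
    using interior_leaf_exists by blast
  with G assms(3) show ?thesis
    using second_neumann_eigenvalue_le_2 largest_neumann_eigenvalue_ge_2 by blast
qed

end
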